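(* Let $X$ and $Y$ be absolutely continuous random variables supported on a common set $S$, with probability density functions $f$ and $g$ respectively. Let $\phi$ be a strictly monotone transformation on $S$, differentiable with $\phi'(x)\neq 0$ for $x\in S$, and let $\tilde X=\phi(X)$ and $\tilde Y=\phi(Y)$, with probability density functions $\tilde f$ and $\tilde g$ respectively. Then $$\mathrm{VarJ}^w(\tilde X,\tilde Y)=\frac14\,\mathrm{Var}_f\!\left[\frac{\phi(X)}{\phi'(X)}\,g(X)\right].$$
   Context: For random variables $U,V$ with probability density functions $p,q$ on a common support, the weighted extropy inaccuracy is $J^w(U,V)=-\frac12\int x\,p(x)q(x)\,dx$, and the varjwinaccuracy (weighted measure of inaccuracy of $U$ with respect to $V$ based on varextropy) is $$\mathrm{VarJ}^w(U,V)=\frac14\int x^2 q^2(x)p(x)\,dx-\left[J^w(U,V)\right]^2,$$ where the integrals are over the common support. $\mathrm{Var}_f[h(X)]$ denotes the variance of $h(X)$ when $X$ has density $f$, i.e. $\int h^2 f\,dx-\left(\int h f\,dx\right)^2$. The integrals appearing in these quantities are assumed to be finite. "Common support $S$" means that $S$ is a set such that, up to Lebesgue-null sets, $f>0$ and $g>0$ exactly on $S$. *)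

theory Defs
  imports "HOL-Probability.Probability"
begin

definition has_pdf :: "'a measure \<Rightarrow> ('a \<Rightarrow> real) \<Rightarrow> (real \<Rightarrow> real) \<Rightarrow> bool" where
  "has_pdf M X f \<longleftrightarrow> (\<forall>x. 0 \<le> f x) \<and> distributed M lborel X (\<lambda>x. ennreal (f x))"

definition common_support :: "real set \<Rightarrow> (real \<Rightarrow> real) \<Rightarrow> (real \<Rightarrow> real) \<Rightarrow> bool" where
  "common_support S p q \<longleftrightarrow>
     (AE x in lborel. x \<in> S \<longleftrightarrow> 0 < p x) \<and> (AE x in lborel. x \<in> S \<longleftrightarrow> 0 < q x)"

text \<open>
  A common support is determined only up to a null set, so it need not be a Borel set. The
  integrals below are therefore taken with respect to \<^const>\<open>lebesgue\<close>, the completion of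
  \<^const>\<open>lborel\<close>. The argument \<open>S\<close> is the common support of the densities \<open>p\<close> and \<open>q\<close>.
\<close>

definition weighted_extropy_inaccuracy ::
  "real set \<Rightarrow> (real \<Rightarrow> real) \<Rightarrow> (real \<Rightarrow> real) \<Rightarrow> real" where
  "weighted_extropy_inaccuracy S p q = - (1 / 2) * (LINT x:S|lebesgue. x * p x * q x)"

definition varjwinaccuracy ::
  "real set \<Rightarrow> (real \<Rightarrow> real) \<Rightarrow> (real \<Rightarrow> real) \<Rightarrow> real" where
  "varjwinaccuracy S p q =
     1 / 4 * (LINT x:S|lebesgue. x\<^sup>2 * (q x)\<^sup>2 * p x) - (weighted_extropy_inaccuracy S p q)\<^sup>2"

text \<open>
  The variance of \<open>h(X)\<close> when \<open>X\<close> has density \<open>f\<close>. Values of \<open>h\<close> outside the support of \<open>f\<close>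
  are irrelevant, since \<open>f\<close> vanishes almost everywhere there.
\<close>

definition density_variance :: "(real \<Rightarrow> real) \<Rightarrow> (real \<Rightarrow> real) \<Rightarrow> real" where
  "density_variance f h =
     (LINT x|lebesgue. (h x)\<^sup>2 * f x) - (LINT x|lebesgue. h x * f x)\<^sup>2"

end

theory Submission
  imports Defs
begin

text \<open>
  The transformed densities satisfy \<open>f x = ft (\<phi> x) * \<bar>\<phi>' x\<bar>\<close> almost everywhere on \<open>S\<close>: for
  measurable \<open>A \<subseteq> S\<close> the events \<open>X \<in> A\<close> and \<open>\<phi> X \<in> \<phi> ` A\<close> agree almost surely, so the change of
  variables formula makes both sides integrate to the same value over \<open>A\<close>. Substituting this
  into the two integrals of the inaccuracy turns the second moment into that of
  \<open>\<phi> / \<phi>' * g\<close>, and the first moment too up to the constant sign of \<open>\<phi>'\<close>, which the square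
  removes. The sign of \<open>\<phi>'\<close> is only controlled at limit points of \<open>S\<close>, but the isolated points are
  countable.
\<close>

section \<open>Densities and the probabilities of Lebesgue sets\<close>

lemma has_pdf_integrable:
  assumes "prob_space M" "has_pdf M X f"
  shows "integrable lborel f"
proof -
  interpret prob_space M by fact
  have D: "distributed M lborel X (\<lambda>x. ennreal (f x))" and nn: "\<And>x. 0 \<le> f x"
    using assms(2) by (auto simp: has_pdf_def)
  have [measurable]: "f \<in> borel_measurable lborel"
    using distributed_real_measurable[OF _ D] nn by auto
  have "(\<integral>\<^sup>+x. ennreal (f x) \<partial>lborel) = emeasure M (X -` UNIV \<inter> space M)"
    using distributed_emeasure[OF D, of UNIV] by simp
  then have "(\<integral>\<^sup>+x. ennreal (f x) \<partial>lborel) < \<infinity>"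
    by (simp add: emeasure_space_1)
  then show ?thesis
    using nn by (intro integrableI_nonneg) auto
qed

text \<open>
  Images \<open>\<phi> ` A\<close> are only Lebesgue measurable, so the preimages are events of the completed space.
\<close>

lemma measure_vimage_pdf:
  assumes "prob_space M" "has_pdf M X f" "A \<in> sets lebesgue"
  shows "X -` A \<inter> space M \<in> sets (completion M)"
    and "measure (completion M) (X -` A \<inter> space M) = (LINT x:A|lebesgue. f x)"
proof -
  interpret prob_space M by fact
  have D: "distributed M lborel X (\<lambda>x. ennreal (f x))" and nn: "\<And>x. 0 \<le> f x"
    using assms(2) by (auto simp: has_pdf_def)
  have fm[measurable]: "f \<in> borel_measurable lborel"
    using distributed_real_measurable[OF _ D] nn by auto
  have X[measurable]: "X \<in> measurable M lborel"
    using distributed_measurable[OF D] .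
  \<comment> \<open>A Lebesgue set is a Borel set \<open>B\<close> plus a piece \<open>N\<close> of
    a Borel null set \<open>N'\<close>. As \<open>X\<close> has a density, it hits \<open>N'\<close>
    with probability zero, so only \<open>B\<close> contributes.\<close>
  obtain B N N' where A: "A = B \<union> N" "N \<subseteq> N'" and N': "N' \<in> null_sets lborel" and B: "B \<in> sets lborel"
    using assms(3) by (rule sets_completionE)
  note [measurable] = B
  have AN': "AE x in lborel. x \<notin> N'"
    by (rule AE_not_in[OF N'])
  have "emeasure M (X -` N' \<inter> space M) = (\<integral>\<^sup>+x. ennreal (f x) * indicator N' x \<partial>lborel)"
    using distributed_emeasure[OF D] N' by auto
  also have "\<dots> = (\<integral>\<^sup>+(x::real). 0 \<partial>lborel)"
    using AN' by (intro nn_integral_cong_AE) (auto elim!: eventually_mono)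
  finally have null: "X -` N' \<inter> space M \<in> null_sets M"
    by (auto intro!: null_setsI measurable_sets[OF X] null_setsD2[OF N'])
  have eq: "X -` A \<inter> space M = (X -` B \<inter> space M) \<union> (X -` N \<inter> space M)"
    using A by auto
  have BM: "X -` B \<inter> space M \<in> sets M" by measurable
  show 1: "X -` A \<inter> space M \<in> sets (completion M)"
    by (rule sets_completionI[OF eq _ null BM]) (use A in auto)
  have "measure (completion M) (X -` A \<inter> space M) = measure (completion M) (X -` B \<inter> space M)"
  proof -
    have "AE x in completion M. x \<notin> X -` N' \<inter> space M"
      by (intro AE_completion AE_not_in null)
    then have "AE x in completion M. x \<in> X -` A \<inter> space M \<longleftrightarrow> x \<in> X -` B \<inter> space M"
      using A by (auto elim!: eventually_mono)
    then show ?thesis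
      using 1 BM unfolding measure_def by (subst emeasure_eq_AE) auto
  qed
  also have "\<dots> = measure M (X -` B \<inter> space M)"
    using BM by simp
  also have "\<dots> = (\<integral>\<omega>. indicator B (X \<omega>) \<partial>M)"
  proof -
    have "(\<integral>\<omega>. indicator B (X \<omega>) \<partial>M) = (\<integral>\<omega>. indicator (X -` B \<inter> space M) \<omega> \<partial>M :: real)"
      by (intro Bochner_Integration.integral_cong) (auto simp: indicator_def)
    also have "\<dots> = measure M (X -` B \<inter> space M)"
      by simp
    finally show ?thesis ..
  qed
  also have "\<dots> = (\<integral>x. f x * indicator B x \<partial>lborel)"
    using nn by (intro distributed_integral[OF D, symmetric]) auto
  also have "\<dots> = (\<integral>x. f x * indicator B x \<partial>lebesgue)"
    by (intro integral_completion[symmetric]) measurable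
  also have "\<dots> = (LINT x:A|lebesgue. f x)"
    unfolding set_lebesgue_integral_def
  proof (rule integral_cong_AE)
    have "f \<in> borel_measurable lebesgue" using fm by (rule measurable_completion)
    then show "(\<lambda>x. f x * indicator B x) \<in> borel_measurable lebesgue"
      "(\<lambda>x. indicator A x *\<^sub>R f x) \<in> borel_measurable lebesgue"
      using assms(3) B by (auto intro!: borel_measurable_times borel_measurable_scaleR borel_measurable_indicator)
    show "AE x in lebesgue. f x * indicator B x = indicator A x *\<^sub>R f x"
      using AE_completion[OF AN'] by eventually_elim (use A in \<open>auto simp: indicator_def\<close>)
  qed
  finally show "measure (completion M) (X -` A \<inter> space M) = (LINT x:A|lebesgue. f x)" .
qed

text \<open>\<open>S\<close> differs from the Borel set where \<open>f\<close> is positive only by a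
  null set, and the completion absorbs such differences.\<close>

lemma sets_lebesgue_support:
  fixes f :: "'a::euclidean_space \<Rightarrow> real"
  assumes "AE x in lborel. x \<in> S \<longleftrightarrow> 0 < f x" "f \<in> borel_measurable lborel"
  shows "S \<in> sets lebesgue"
proof -
  note [measurable] = assms(2)
  have "{x \<in> space lborel. 0 < f x} \<in> sets lborel"
    by measurable
  then have pos: "{x. 0 < f x} \<in> sets lebesgue"
    by (intro sets_completionI_sets) simp
  have "AE x in lebesgue. x \<in> {x. 0 < f x} \<longleftrightarrow> x \<in> S"
    using AE_completion[OF assms(1)] by eventually_elim auto
  from completion.in_sets_AE[OF this pos] show ?thesis
    by simp
qed

section \<open>The density of a transformed variable\<close>

text \<open>Stated for a single variable, so that it serves both \<open>X\<close> on
  \<open>M\<close> and \<open>Y\<close> on \<open>N\<close>.\<close>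

lemma pdf_transform_AE:
  assumes "prob_space M" "has_pdf M X f" "has_pdf M (\<lambda>\<omega>. \<phi> (X \<omega>)) ft"
    and supp: "AE x in lborel. x \<in> S \<longleftrightarrow> 0 < f x"
    and inj: "inj_on \<phi> S"
    and der: "\<And>x. x \<in> S \<Longrightarrow> (\<phi> has_real_derivative \<phi>' x) (at x within S)"
  shows "AE x in lebesgue. x \<in> S \<longrightarrow> f x = ft (\<phi> x) * \<bar>\<phi>' x\<bar>"
proof -
  interpret prob_space M by fact
  \<comment> \<open>Since \<open>measure\<close> is also 0 on sets of infinite measure, finiteness
    is what lets measure zero yield a null set below.\<close>
  interpret CM: finite_measure "completion M"
    by (rule finite_measureI) (simp add: emeasure_space_1)
  have nn: "\<And>x. 0 \<le> f x"
    using assms(2) by (simp add: has_pdf_def)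
  have fint: "integrable lborel f" and ftint: "integrable lborel ft"
    using has_pdf_integrable assms by blast+
  have fl: "integrable lebesgue f" and ftl: "integrable lebesgue ft"
    using fint ftint by (auto simp: integrable_completion)
  have S: "S \<in> sets lebesgue"
    using supp fint by (intro sets_lebesgue_support) auto
  \<comment> \<open>Injectivity is known on \<open>S\<close> only, so \<open>X\<close> must first be
    confined to \<open>S\<close>; off \<open>S\<close> the nonnegative \<open>f\<close> vanishes
    almost everywhere.\<close>
  have XS: "AE \<omega> in completion M. X \<omega> \<in> S"
  proof -
    have "measure (completion M) (X -` (-S) \<inter> space M) = (LINT x:-S|lebesgue. f x)"
      using S by (intro measure_vimage_pdf assms(1,2)) (simp add: Compl_in_sets_lebesgue)
    also have "\<dots> = (LINT (x::real)|lebesgue. 0)"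
      unfolding set_lebesgue_integral_def
    proof (rule integral_cong_AE)
      show "AE x in lebesgue. indicator (- S) x *\<^sub>R f x = 0"
        using AE_completion[OF supp] by eventually_elim (use nn in \<open>auto simp: indicator_def not_less intro: antisym\<close>)
      show "(\<lambda>x. indicator (- S) x *\<^sub>R f x) \<in> borel_measurable lebesgue"
        using S fl by (auto intro!: borel_measurable_scaleR borel_measurable_indicator Compl_in_sets_lebesgue[THEN iffD2])
    qed auto
    finally have "measure (completion M) (X -` (-S) \<inter> space M) = 0" by simp
    moreover have "X -` (-S) \<inter> space M \<in> sets (completion M)"
      using S by (intro measure_vimage_pdf(1)[OF assms(1,2)]) (simp add: Compl_in_sets_lebesgue)
    ultimately have "X -` (-S) \<inter> space M \<in> null_sets (completion M)"
      by (auto simp: null_sets_def CM.emeasure_eq_measure)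
    from AE_not_in[OF this] show ?thesis
      using AE_space by eventually_elim auto
  qed
  have im: "\<phi> ` A \<in> sets lebesgue"
    and eq: "(LINT x:A|lebesgue. f x) = (LINT x:A|lebesgue. \<bar>\<phi>' x\<bar> * ft (\<phi> x))"
    and int: "set_integrable lebesgue A (\<lambda>x. \<bar>\<phi>' x\<bar> * ft (\<phi> x))"
    if A: "A \<in> sets lebesgue" "A \<subseteq> S" for A
  proof -
    have derA: "\<And>x. x \<in> A \<Longrightarrow> (\<phi> has_real_derivative \<phi>' x) (at x within A)"
      using A der by (meson DERIV_subset subsetD)
    have injA: "inj_on \<phi> A" using inj A by (meson inj_on_subset)
    show im: "\<phi> ` A \<in> sets lebesgue"
      using A derA by (intro differentiable_image_in_sets_lebesgue)
        (auto simp: differentiable_on_def intro: differentiableI has_field_derivative_imp_has_derivative)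
    have ftA: "set_integrable lebesgue (\<phi> ` A) ft"
      using integrable_mult_indicator[OF im ftl] by (simp add: set_integrable_def)
    \<comment> \<open>The library rule is an equivalence about a prescribed value of the integral.
      Prescribing the actual integral of \<open>ft\<close> over the image gives both integrability
      and equality of the integrals.\<close>
    from has_absolute_integral_change_of_variables_1'[OF A(1) derA injA, of ft "integral (\<phi> ` A) ft"] ftA
    show int: "set_integrable lebesgue A (\<lambda>x. \<bar>\<phi>' x\<bar> * ft (\<phi> x))" by blast
    from has_absolute_integral_change_of_variables_1'[OF A(1) derA injA, of ft "integral (\<phi> ` A) ft"] ftA
    have 1: "(LINT x:A|lebesgue. \<bar>\<phi>' x\<bar> * ft (\<phi> x)) = (LINT y:\<phi> ` A|lebesgue. ft y)"
      using int by (simp add: set_lebesgue_integral_eq_integral(2))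
    have "(LINT x:A|lebesgue. f x) = measure (completion M) (X -` A \<inter> space M)"
      using measure_vimage_pdf(2)[OF assms(1,2) A(1)] by simp
    also have "\<dots> = measure (completion M) ((\<lambda>\<omega>. \<phi> (X \<omega>)) -` (\<phi> ` A) \<inter> space M)"
    proof -
      \<comment> \<open>From left to right this is trivial. Conversely, \<open>X \<omega>\<close>
        and some point of \<open>A\<close> have the same image and both lie in \<open>S\<close>, so
        they coincide.\<close>
      have "AE \<omega> in completion M. \<omega> \<in> X -` A \<inter> space M \<longleftrightarrow> \<omega> \<in> (\<lambda>\<omega>. \<phi> (X \<omega>)) -` (\<phi> ` A) \<inter> space M"
        using XS by eventually_elim (use A inj in \<open>auto dest: inj_onD\<close>)
      then show ?thesis
        using measure_vimage_pdf(1)[OF assms(1,2) A(1)] measure_vimage_pdf(1)[OF assms(1,3) im]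
        unfolding measure_def by (subst emeasure_eq_AE) auto
    qed
    also have "\<dots> = (LINT y:\<phi> ` A|lebesgue. ft y)"
      by (rule measure_vimage_pdf(2)[OF assms(1,3) im])
    finally show "(LINT x:A|lebesgue. f x) = (LINT x:A|lebesgue. \<bar>\<phi>' x\<bar> * ft (\<phi> x))"
      using 1 by simp
  qed
  have "AE x in lebesgue. indicator S x *\<^sub>R f x = indicator S x *\<^sub>R (\<bar>\<phi>' x\<bar> * ft (\<phi> x))"
  proof (rule density_unique_real)
    show "integrable lebesgue (\<lambda>x. indicator S x *\<^sub>R f x)"
      using integrable_mult_indicator[OF S fl] .
    show "integrable lebesgue (\<lambda>x. indicator S x *\<^sub>R (\<bar>\<phi>' x\<bar> * ft (\<phi> x)))"
      using int[OF S] by (simp add: set_integrable_def)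
    fix A :: "real set" assume A: "A \<in> sets lebesgue"
    \<comment> \<open>Uniqueness of densities tests against every Lebesgue set \<open>A\<close>; the
      indicator of \<open>S\<close> cuts it down to a subset of \<open>S\<close>, where
      \<open>eq\<close> applies.\<close>
    have *: "(LINT x:A|lebesgue. indicator S x *\<^sub>R h x) = (LINT x:A \<inter> S|lebesgue. h x)" for h :: "real \<Rightarrow> real"
      unfolding set_lebesgue_integral_def
      by (intro Bochner_Integration.integral_cong) (auto simp: indicator_def)
    show "(LINT x:A|lebesgue. indicator S x *\<^sub>R f x) =
        (LINT x:A|lebesgue. indicator S x *\<^sub>R (\<bar>\<phi>' x\<bar> * ft (\<phi> x)))"
      unfolding * using A S by (intro eq) auto
  qed
  then show ?thesis
    by eventually_elim (auto simp: indicator_def mult.commute)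
qed

section \<open>The sign of the derivative\<close>

text \<open>An isolated point is the only point of \<open>S\<close> in some basic open set, so
  distinct isolated points pick distinct members of a countable basis.\<close>

lemma countable_isolated_points:
  fixes S :: "'a::second_countable_topology set"
  shows "countable {x \<in> S. \<not> x islimpt S}"
proof -
  obtain \<B> :: "'a set set" where B: "countable \<B>" "topological_basis \<B>"
    using ex_countable_basis by blast
  have "\<exists>U\<in>\<B>. U \<inter> S = {x}" if "x \<in> S" "\<not> x islimpt S" for x
  proof -
    from that obtain T where T: "open T" "x \<in> T" "T \<inter> S \<subseteq> {x}"
      by (auto simp: islimpt_def)
    obtain U where "U \<in> \<B>" "x \<in> U" "U \<subseteq> T"
      using topological_basisE[OF B(2) T(1,2)] by metis
    with T that show ?thesis by blast
  qed
  then obtain U where U: "\<And>x. x \<in> S \<Longrightarrow> \<not> x islimpt S \<Longrightarrow> U x \<in> \<B> \<and> U x \<inter> S = {x}"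
    by metis
  have "inj_on U {x \<in> S. \<not> x islimpt S}"
    by (rule inj_onI) (use U in blast)
  moreover have "U ` {x \<in> S. \<not> x islimpt S} \<subseteq> \<B>"
    using U by blast
  ultimately show ?thesis
    using B(1) by (metis countable_image_inj_on countable_subset)
qed

text \<open>Difference quotients of an increasing function are nonnegative, and so is their limit.
  At an isolated point the filter is trivial and every number is a derivative, hence the limit point
  assumption.\<close>

lemma mono_on_imp_deriv_nonneg_within:
  fixes \<phi> :: "real \<Rightarrow> real"
  assumes "mono_on S \<phi>" "x \<in> S" "x islimpt S" "(\<phi> has_real_derivative d) (at x within S)"
  shows "0 \<le> d"
proof -
  have "((\<lambda>y. (\<phi> y - \<phi> x) / (y - x)) \<longlongrightarrow> d) (at x within S)"
    using assms(4) by (simp add: has_field_derivative_iff)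
  moreover have "0 \<le> (\<phi> y - \<phi> x) / (y - x)" if "y \<in> S" for y
    using mono_onD[OF assms(1,2) that] mono_onD[OF assms(1) that assms(2)]
    by (cases "x \<le> y") (auto simp: divide_nonpos_nonpos)
  then have "\<forall>\<^sub>F y in at x within S. 0 \<le> (\<phi> y - \<phi> x) / (y - x)"
    by (auto simp: eventually_at_filter)
  ultimately show ?thesis
    using assms(3) trivial_limit_within by (intro tendsto_lowerbound) blast+
qed

text \<open>A single constant \<open>s\<close> serves all of \<open>S\<close>, so it can be pulled
  out of an integral. The decreasing case is the increasing one for the negated function.\<close>

lemma strictly_monotone_deriv_sign_AE:
  fixes \<phi> \<phi>' :: "real \<Rightarrow> real"
  assumes mono: "strict_mono_on S \<phi> \<or> strict_antimono_on S \<phi>"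
    and der: "\<And>x. x \<in> S \<Longrightarrow> (\<phi> has_real_derivative \<phi>' x) (at x within S)"
  obtains s where "s = 1 \<or> s = -1" "AE x in lebesgue. x \<in> S \<longrightarrow> \<bar>\<phi>' x\<bar> = s * \<phi>' x"
proof -
  let ?I = "{x \<in> S. \<not> x islimpt S}"
  have "?I \<in> null_sets lborel"
    by (intro countable_imp_null_set_lborel countable_isolated_points)
  then have ae: "AE x in lebesgue. x \<notin> ?I"
    by (intro AE_completion AE_not_in)
  show thesis
    using mono
  proof
    assume m: "strict_mono_on S \<phi>"
    have "AE x in lebesgue. x \<in> S \<longrightarrow> \<bar>\<phi>' x\<bar> = 1 * \<phi>' x"
      using ae by eventually_elim
        (use mono_on_imp_deriv_nonneg_within[OF strict_mono_on_imp_mono_on[OF m]] der in auto)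
    then show thesis by (rule that[rotated]) simp
  next
    assume "strict_antimono_on S \<phi>"
    then have m: "mono_on S (\<lambda>x. - \<phi> x)"
      by (auto simp: monotone_on_def le_less)
    have "AE x in lebesgue. x \<in> S \<longrightarrow> \<bar>\<phi>' x\<bar> = -1 * \<phi>' x"
      using ae
    proof eventually_elim
      case (elim x)
      then show ?case
        using mono_on_imp_deriv_nonneg_within[OF m, of x "- \<phi>' x"] der[of x]
          DERIV_minus[of \<phi> "\<phi>' x" x S]
        by auto
    qed
    then show thesis by (rule that[rotated]) simp
  qed
qed

section \<open>Pulling the moments back to \<open>S\<close>\<close>

text \<open>The density relations hold only almost everywhere, and \<open>density_variance\<close>
  integrates over the whole line. Hence \<open>G\<close> need only match the pulled-back integrand
  almost everywhere on \<open>S\<close> and vanish almost everywhere off it.\<close>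

lemma set_integral_change_of_variables_AE:
  fixes F G \<phi> \<phi>' :: "real \<Rightarrow> real"
  assumes S: "S \<in> sets lebesgue" and inj: "inj_on \<phi> S"
    and der: "\<And>x. x \<in> S \<Longrightarrow> (\<phi> has_real_derivative \<phi>' x) (at x within S)"
    and F: "set_integrable lebesgue (\<phi> ` S) F"
    and G: "G \<in> borel_measurable lebesgue"
    and eq: "AE x in lebesgue. x \<in> S \<longrightarrow> \<bar>\<phi>' x\<bar> * F (\<phi> x) = G x"
    and zero: "AE x in lebesgue. x \<notin> S \<longrightarrow> G x = 0"
  shows "(LINT y:\<phi> ` S|lebesgue. F y) = (LINT x|lebesgue. G x)"
proof -
  note cv = has_absolute_integral_change_of_variables_1'[OF S der inj, of F "integral (\<phi> ` S) F"]
  have int: "set_integrable lebesgue S (\<lambda>x. \<bar>\<phi>' x\<bar> * F (\<phi> x))"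
    using cv F by blast
  have "(LINT y:\<phi> ` S|lebesgue. F y) = (LINT x:S|lebesgue. \<bar>\<phi>' x\<bar> * F (\<phi> x))"
    using cv F int by (simp add: set_lebesgue_integral_eq_integral(2))
  also have "\<dots> = (LINT x|lebesgue. G x)"
    unfolding set_lebesgue_integral_def
  proof (rule integral_cong_AE)
    show "(\<lambda>x. indicator S x *\<^sub>R (\<bar>\<phi>' x\<bar> * F (\<phi> x))) \<in> borel_measurable lebesgue"
      using int by (auto simp: set_integrable_def)
    show "AE x in lebesgue. indicator S x *\<^sub>R (\<bar>\<phi>' x\<bar> * F (\<phi> x)) = G x"
      using eq zero by eventually_elim (auto simp: indicator_def)
  qed (rule G)
  finally show ?thesis .
qed

theorem theorem3p3:
  fixes M :: "'a measure" and N :: "'b measure"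
    and X :: "'a \<Rightarrow> real" and Y :: "'b \<Rightarrow> real"
    and f g ft gt \<phi> \<phi>' :: "real \<Rightarrow> real"
    and S :: "real set"
  assumes "prob_space M" and "prob_space N"
    and "has_pdf M X f" and "has_pdf N Y g"
    and "common_support S f g"
    and "strict_mono_on S \<phi> \<or> strict_antimono_on S \<phi>"
    and "\<And>x. x \<in> S \<Longrightarrow> (\<phi> has_real_derivative \<phi>' x) (at x within S)"
    and "\<And>x. x \<in> S \<Longrightarrow> \<phi>' x \<noteq> 0"
    and "has_pdf M (\<lambda>\<omega>. \<phi> (X \<omega>)) ft" and "has_pdf N (\<lambda>\<omega>. \<phi> (Y \<omega>)) gt"
    and "set_integrable lebesgue (\<phi> ` S) (\<lambda>y. y * ft y * gt y)"
    and "set_integrable lebesgue (\<phi> ` S) (\<lambda>y. y\<^sup>2 * (gt y)\<^sup>2 * ft y)"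
    and "integrable lebesgue (\<lambda>x. (\<phi> x / \<phi>' x * g x) * f x)"
    and "integrable lebesgue (\<lambda>x. (\<phi> x / \<phi>' x * g x)\<^sup>2 * f x)"
  shows "varjwinaccuracy (\<phi> ` S) ft gt =
           1 / 4 * density_variance f (\<lambda>x. \<phi> x / \<phi>' x * g x)"
proof -
  have suppf: "AE x in lborel. x \<in> S \<longleftrightarrow> 0 < f x" and suppg: "AE x in lborel. x \<in> S \<longleftrightarrow> 0 < g x"
    using assms(5) by (auto simp: common_support_def)
  have S: "S \<in> sets lebesgue"
    using suppf has_pdf_integrable[OF assms(1,3)] by (intro sets_lebesgue_support) auto
  have inj: "inj_on \<phi> S"
    using assms(6)
  proof
    assume "strict_antimono_on S \<phi>"
    then show ?thesis
      by (intro linorder_inj_onI') (fastforce simp: monotone_on_def)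
  qed (rule strict_mono_on_imp_inj_on)
  have f: "AE x in lebesgue. x \<in> S \<longrightarrow> f x = ft (\<phi> x) * \<bar>\<phi>' x\<bar>"
    using pdf_transform_AE[OF assms(1,3,9) suppf inj assms(7)] by blast
  have g: "AE x in lebesgue. x \<in> S \<longrightarrow> g x = gt (\<phi> x) * \<bar>\<phi>' x\<bar>"
    using pdf_transform_AE[OF assms(2,4,10) suppg inj assms(7)] by blast
  have f0: "AE x in lebesgue. x \<notin> S \<longrightarrow> f x = 0"
    using AE_completion[OF suppf] assms(3) unfolding has_pdf_def
    by (auto elim!: eventually_mono intro: antisym simp: not_less)
  obtain s :: real where s: "s = 1 \<or> s = -1" and sgn: "AE x in lebesgue. x \<in> S \<longrightarrow> \<bar>\<phi>' x\<bar> = s * \<phi>' x"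
    using strictly_monotone_deriv_sign_AE[OF assms(6,7)] by blast
  have "(LINT y:\<phi> ` S|lebesgue. y * ft y * gt y) = (LINT x|lebesgue. s * (\<phi> x / \<phi>' x * g x * f x))"
  proof (rule set_integral_change_of_variables_AE[OF S inj assms(7) assms(11)])
    \<comment> \<open>The two densities contribute the square of
      \<open>\<bar>\<phi>' x\<bar>\<close> on the right. One factor remains, while the other is
      \<open>s * \<phi>' x\<close> and cancels against \<open>s / \<phi>' x\<close>, because
      \<open>s * s = 1\<close>.\<close>
    show "AE x in lebesgue. x \<in> S \<longrightarrow>
        \<bar>\<phi>' x\<bar> * (\<phi> x * ft (\<phi> x) * gt (\<phi> x)) = s * (\<phi> x / \<phi>' x * g x * f x)"
      using f g sgn by eventually_elim (use s assms(8) in \<open>auto simp: field_simps\<close>)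
    show "AE x in lebesgue. x \<notin> S \<longrightarrow> s * (\<phi> x / \<phi>' x * g x * f x) = 0"
      using f0 by eventually_elim auto
    show "(\<lambda>x. s * (\<phi> x / \<phi>' x * g x * f x)) \<in> borel_measurable lebesgue"
      using borel_measurable_integrable[OF integrable_mult_right[OF assms(13), of s]] .
  qed auto
  then have J: "(LINT y:\<phi> ` S|lebesgue. y * ft y * gt y)\<^sup>2 = (LINT x|lebesgue. \<phi> x / \<phi>' x * g x * f x)\<^sup>2"
    using s by (auto simp: power_mult_distrib)
  have "(LINT y:\<phi> ` S|lebesgue. y\<^sup>2 * (gt y)\<^sup>2 * ft y) = (LINT x|lebesgue. (\<phi> x / \<phi>' x * g x)\<^sup>2 * f x)"
  proof (rule set_integral_change_of_variables_AE[OF S inj assms(7) assms(12)])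
    \<comment> \<open>Here \<open>g\<close> enters squared, so its Jacobian factor cancels the
      squared denominator without any sign; the remaining \<open>\<bar>\<phi>' x\<bar>\<close> comes
      from \<open>f\<close>.\<close>
    show "AE x in lebesgue. x \<in> S \<longrightarrow>
        \<bar>\<phi>' x\<bar> * ((\<phi> x)\<^sup>2 * (gt (\<phi> x))\<^sup>2 * ft (\<phi> x)) = (\<phi> x / \<phi>' x * g x)\<^sup>2 * f x"
      using f g by eventually_elim (use assms(8) in \<open>auto simp: power_mult_distrib power_divide\<close>)
    show "AE x in lebesgue. x \<notin> S \<longrightarrow> (\<phi> x / \<phi>' x * g x)\<^sup>2 * f x = 0"
      using f0 by eventually_elim auto
  qed (use assms(14) in auto)
  then show ?thesis
    unfolding varjwinaccuracy_def weighted_extropy_inaccuracy_def density_variance_def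
    using J by (simp add: power_mult_distrib power2_eq_square algebra_simps)
qed

end
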